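(* Let $0<p<\infty$, let $\Omega=(\Omega_n)_{n=0}^\infty\subset[0,\infty)$ with $\Omega_0\ne0$, and let $W_n=\sum_{k=0}^n\Omega_k$, $n=0,1,2,\dots$ Then: (i) $\|\cdot\|_{d^\infty(\Omega,p)}$ is a norm if and only if $\Omega=(\Omega_0,0,0,\dots)$. (ii) $d^\infty(\Omega,p)$ is normable if and only if there is $C<\infty$ such that $$\sum_{k=0}^n\frac1{W_k^{1/p}}\le C\,\frac{n+1}{W_n^{1/p}},\qquad n=0,1,2,\dots$$
   Context: For a complex sequence $f=(f(n))_{n\ge0}$, $f^*$ is its nonincreasing rearrangement, $f^*(n)=\inf\{s>0:\#\{k:|f(k)|>s\}\le n\}$. For $0<p<\infty$, $\|f\|_{d^\infty(\Omega,p)}=\sup_{n\ge0}W_n^{1/p}f^*(n)$ and $d^\infty(\Omega,p)=\{f:\|f\|_{d^\infty(\Omega,p)}<\infty\}$. The space is normable if there is a norm on it equivalent to the functional $\|\cdot\|_{d^\infty(\Omega,p)}$. *)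

theory Defs
  imports Complex_Main "HOL-Library.Function_Algebras" "HOL-Library.Extended_Nonnegative_Real"
begin

text \<open>
  The vector space of all complex sequences over the complex field. Addition, negation and zero
  on sequences are the pointwise ones of \<^theory>\<open>HOL-Library.Function_Algebras\<close>.
\<close>

definition seq_scale :: "complex \<Rightarrow> (nat \<Rightarrow> complex) \<Rightarrow> (nat \<Rightarrow> complex)" where
  "seq_scale c f = (\<lambda>n. c * f n)"

interpretation cseq: vector_space seq_scale
  by unfold_locales (simp_all add: seq_scale_def fun_eq_iff algebra_simps)

text \<open>Only the values of \<open>N\<close> on \<open>V\<close> matter. A set that is not a linear subspace carries no norm.\<close>

definition is_norm_on :: "(nat \<Rightarrow> complex) set \<Rightarrow> ((nat \<Rightarrow> complex) \<Rightarrow> real) \<Rightarrow> bool" where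
  "is_norm_on V N \<longleftrightarrow>
     cseq.subspace V \<and>
     (\<forall>f\<in>V. N f \<ge> 0) \<and>
     (\<forall>f\<in>V. N f = 0 \<longleftrightarrow> f = 0) \<and>
     (\<forall>c. \<forall>f\<in>V. N (seq_scale c f) = cmod c * N f) \<and>
     (\<forall>f\<in>V. \<forall>g\<in>V. N (f + g) \<le> N f + N g)"

text \<open>
  The rearrangement takes values in \<open>[0, \<infinity>]\<close>: the infimum of the empty set is \<open>\<infinity>\<close>, which happens
  exactly when \<open>f\<close> is unbounded. The finiteness conjunct is needed because the cardinality
  of an infinite set is 0.
\<close>

definition rearrangement :: "(nat \<Rightarrow> complex) \<Rightarrow> nat \<Rightarrow> ennreal" where
  "rearrangement f n =
     Inf {ennreal s | s::real.
            s > 0 \<and> finite {k. cmod (f k) > s} \<and> card {k. cmod (f k) > s} \<le> n}"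

definition weight_sum :: "(nat \<Rightarrow> real) \<Rightarrow> nat \<Rightarrow> real" where
  "weight_sum \<Omega> n = (\<Sum>k\<le>n. \<Omega> k)"

definition d_inf_norm :: "(nat \<Rightarrow> real) \<Rightarrow> real \<Rightarrow> (nat \<Rightarrow> complex) \<Rightarrow> ennreal" where
  "d_inf_norm \<Omega> p f = (SUP n. ennreal (weight_sum \<Omega> n powr (1 / p)) * rearrangement f n)"

definition d_inf :: "(nat \<Rightarrow> real) \<Rightarrow> real \<Rightarrow> (nat \<Rightarrow> complex) set" where
  "d_inf \<Omega> p = {f. d_inf_norm \<Omega> p f < \<infinity>}"

text \<open>On \<^const>\<open>d_inf\<close> the functional is finite, so \<^const>\<open>enn2real\<close> loses no information there.\<close>

definition d_inf_normable :: "(nat \<Rightarrow> real) \<Rightarrow> real \<Rightarrow> bool" where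
  "d_inf_normable \<Omega> p \<longleftrightarrow>
     (\<exists>N. is_norm_on (d_inf \<Omega> p) N \<and>
        (\<exists>a b. 0 < a \<and> 0 < b \<and>
           (\<forall>f\<in>d_inf \<Omega> p. a * enn2real (d_inf_norm \<Omega> p f) \<le> N f \<and>
                            N f \<le> b * enn2real (d_inf_norm \<Omega> p f))))"

end

theory Submission
  imports Defs
begin

text \<open>
  Write \<open>w\<^sub>n = W\<^sub>n\<^bsup>1/p\<^esup>\<close>. Summing the \<open>n + 1\<close> cyclic shifts of \<open>(1/w\<^sub>0, \<dots>, 1/w\<^sub>n)\<close>, each of which has
  functional at most 1, gives a sequence that is constant on \<open>{0..n}\<close>; hence a norm \<open>N\<close> with
  \<open>a \<parallel>f\<parallel> \<le> N f \<le> b \<parallel>f\<parallel>\<close> forces the condition in (ii) with \<open>C = b / a\<close>. Conversely, that condition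
  makes the supremum over finite sets \<open>A\<close> of \<open>w\<^bsub>|A|-1\<^esub>\<close> times the mean of \<open>|f|\<close> over \<open>A\<close> a norm
  between \<open>\<parallel>f\<parallel>\<close> and \<open>C \<parallel>f\<parallel>\<close>. Part (i) is the case \<open>C = 1\<close>, in which monotonicity of \<open>w\<close> makes
  \<open>w\<close> constant.
\<close>

section \<open>Estimating the rearrangement by finite index sets\<close>

lemma rearrangement_ge:
  assumes "finite A" "n < card A" "\<And>k. k \<in> A \<Longrightarrow> c \<le> cmod (f k)"
  shows "ennreal c \<le> rearrangement f n"
  unfolding rearrangement_def
proof (rule Inf_greatest, clarify)
  fix s :: real
  assume s: "s > 0" "finite {k. cmod (f k) > s}" "card {k. cmod (f k) > s} \<le> n"
  show "ennreal c \<le> ennreal s"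
  proof (cases "c \<le> s")
    case False
    then have "A \<subseteq> {k. cmod (f k) > s}"
      using assms(3) by force
    then have "card A \<le> n"
      using s card_mono le_trans by blast
    then show ?thesis using assms(2) by simp
  qed (simp add: ennreal_leI)
qed

text \<open>Sets of exactly \<open>Suc n\<close> indices also settle finiteness: a level set that is
  infinite or has more than \<open>n\<close> elements contains such a set, and on it
  \<open>cmod (f k)\<close> stays above \<open>s\<close>.\<close>

lemma rearrangement_le:
  assumes "s > 0" "\<And>A. finite A \<Longrightarrow> card A = Suc n \<Longrightarrow> \<exists>k\<in>A. cmod (f k) \<le> s"
  shows "rearrangement f n \<le> ennreal s"
proof -
  let ?B = "{k. cmod (f k) > s}"
  have no_subset: "\<not> (B \<subseteq> ?B \<and> finite B \<and> card B = Suc n)" for B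
    using assms(2)[of B] by force
  have fin: "finite ?B"
    using no_subset infinite_arbitrarily_large[of ?B "Suc n"] by blast
  have "card ?B \<le> n"
  proof (rule ccontr)
    assume "\<not> card ?B \<le> n"
    then obtain B where "B \<subseteq> ?B" "card B = Suc n" "finite B"
      using obtain_subset_with_card_n[of "Suc n" ?B] by (metis not_less_eq_eq)
    then show False using no_subset by blast
  qed
  with fin assms(1) show ?thesis
    unfolding rearrangement_def by (intro Inf_lower) blast
qed

section \<open>Norms on subspaces of sequences\<close>

lemma is_norm_on_cong:
  assumes "is_norm_on V N" "\<And>f. f \<in> V \<Longrightarrow> N f = N' f"
  shows "is_norm_on V N'"
proof -
  have "cseq.subspace V" using assms(1) by (simp add: is_norm_on_def)
  then have "f + g \<in> V" "seq_scale c f \<in> V" if "f \<in> V" "g \<in> V" for f g c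
    using that by (simp_all add: cseq.subspace_def)
  with assms(1) show ?thesis
    by (simp add: is_norm_on_def flip: assms(2))
qed

lemma is_norm_on_sum_le:
  assumes N: "is_norm_on V N" and "finite I" "\<And>i. i \<in> I \<Longrightarrow> f i \<in> V"
  shows "N (\<Sum>i\<in>I. f i) \<le> (\<Sum>i\<in>I. N (f i))"
  using assms(2,3)
proof (induction I rule: finite_induct)
  case empty
  have "(0::nat \<Rightarrow> complex) \<in> V"
    using N by (simp add: is_norm_on_def cseq.subspace_def)
  then have "N 0 = 0" using N by (simp add: is_norm_on_def)
  then show ?case by (simp only: sum.empty)
next
  case (insert i I)
  have "(\<Sum>i\<in>I. f i) \<in> V"
    using N insert.prems by (intro cseq.subspace_sum) (auto simp: is_norm_on_def)
  then have "N (f i + (\<Sum>i\<in>I. f i)) \<le> N (f i) + N (\<Sum>i\<in>I. f i)"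
    using N insert.prems by (simp add: is_norm_on_def)
  moreover have "N (\<Sum>i\<in>I. f i) \<le> (\<Sum>i\<in>I. N (f i))"
    using insert by simp
  ultimately show ?case unfolding sum.insert[OF insert.hyps] by linarith
qed

section \<open>The weights and their partial sums\<close>

locale lorentz_weight =
  fixes \<Omega> :: "nat \<Rightarrow> real" and p :: real
  assumes p_pos: "0 < p"
    and weight_nonneg: "\<And>n. \<Omega> n \<ge> 0"
    and weight_0: "\<Omega> 0 \<noteq> 0"
begin

definition w :: "nat \<Rightarrow> real" where
  "w n = weight_sum \<Omega> n powr (1 / p)"

lemma weight_sum_pos: "weight_sum \<Omega> n > 0"
  unfolding weight_sum_def
  by (rule sum_pos2[of _ 0]) (use weight_0 weight_nonneg in \<open>auto simp: less_le\<close>)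

lemma weight_sum_mono: "m \<le> n \<Longrightarrow> weight_sum \<Omega> m \<le> weight_sum \<Omega> n"
  unfolding weight_sum_def by (rule sum_mono2) (use weight_nonneg in auto)

lemma w_pos [simp]: "w n > 0"
  using weight_sum_pos[of n] by (simp add: w_def)

lemma w_nonneg [simp]: "w n \<ge> 0" and w_nonzero [simp]: "w n \<noteq> 0"
  using w_pos[of n] by linarith+

lemma w_mono: "m \<le> n \<Longrightarrow> w m \<le> w n"
  unfolding w_def
  by (rule powr_mono2) (use p_pos weight_sum_mono[of m n] weight_sum_pos[of m] in auto)

text \<open>Raising to the power \<open>p\<close> undoes the exponent \<open>1 / p\<close>. This
  lets constancy of \<open>w\<close> be read as a statement about \<Omega>.\<close>

lemma w_eq_iff: "w n = w 0 \<longleftrightarrow> weight_sum \<Omega> n = weight_sum \<Omega> 0"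
proof
  assume "w n = w 0"
  then have "(weight_sum \<Omega> n powr (1 / p)) powr p = (weight_sum \<Omega> 0 powr (1 / p)) powr p"
    by (simp add: w_def)
  then show "weight_sum \<Omega> n = weight_sum \<Omega> 0"
    using p_pos weight_sum_pos[of n] weight_sum_pos[of 0] by (simp add: powr_powr)
qed (simp add: w_def)

section \<open>The functional without rearrangements\<close>

lemma d_inf_norm_ge:
  assumes "finite A" "A \<noteq> {}" "\<And>k. k \<in> A \<Longrightarrow> c \<le> cmod (f k)"
  shows "ennreal (w (card A - 1) * c) \<le> d_inf_norm \<Omega> p f"
proof -
  have "card A - 1 < card A" using assms by (simp add: card_gt_0_iff)
  then have "ennreal (w (card A - 1)) * ennreal c \<le> ennreal (w (card A - 1)) * rearrangement f (card A - 1)"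
    using assms by (intro mult_left_mono rearrangement_ge) auto
  also have "\<dots> \<le> d_inf_norm \<Omega> p f"
    unfolding d_inf_norm_def w_def by (rule SUP_upper) simp
  finally show ?thesis by (simp add: ennreal_mult')
qed

text \<open>Converse of \<open>d_inf_norm_ge\<close>: together they present the functional as the
  supremum of \<open>w (card A - 1) * c\<close> over nonempty finite \<open>A\<close> on which
  \<open>cmod (f k)\<close> is at least \<open>c\<close>. The later estimates rest on this
  form.\<close>

lemma d_inf_norm_le:
  assumes "M \<ge> 0"
    and M: "\<And>A c. finite A \<Longrightarrow> A \<noteq> {} \<Longrightarrow> c > 0 \<Longrightarrow> (\<And>k. k \<in> A \<Longrightarrow> c \<le> cmod (f k)) \<Longrightarrow> w (card A - 1) * c \<le> M"
  shows "d_inf_norm \<Omega> p f \<le> ennreal M"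
  unfolding d_inf_norm_def
proof (rule SUP_least)
  fix n
  have "rearrangement f n \<le> ennreal (M / w n)"
  \<comment> \<open>The slack \<open>e\<close> has two uses: the level in
    \<open>rearrangement_le\<close> must be positive even if \<open>M = 0\<close>, and a set on
    which \<open>cmod (f k)\<close> exceeds \<open>M / w n + e\<close> would give
    \<open>M + w n * e \<le> M\<close>.\<close>
  proof (rule ennreal_le_epsilon)
    fix e :: real assume e: "e > 0"
    have pos: "M / w n + e > 0" using e \<open>M \<ge> 0\<close> by (simp add: add_nonneg_pos)
    have "\<exists>k\<in>A. cmod (f k) \<le> M / w n + e" if "finite A" "card A = Suc n" for A
    proof (rule ccontr)
      assume "\<not> ?thesis"
      then have "w (card A - 1) * (M / w n + e) \<le> M"
        using that pos by (intro M) (auto intro: less_imp_le)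
      then have "w n * e \<le> 0" using that by (simp add: distrib_left)
      then show False using e mult_pos_pos[OF w_pos e, of n] by simp
    qed
    then have "rearrangement f n \<le> ennreal (M / w n + e)"
      using pos by (intro rearrangement_le)
    then show "rearrangement f n \<le> ennreal (M / w n) + ennreal e"
      using \<open>M \<ge> 0\<close> e by (simp add: ennreal_plus)
  qed
  then have "ennreal (w n) * rearrangement f n \<le> ennreal (w n) * ennreal (M / w n)"
    by (intro mult_left_mono) auto
  also have "\<dots> = ennreal M" using \<open>M \<ge> 0\<close> by (simp flip: ennreal_mult)
  finally show "ennreal (weight_sum \<Omega> n powr (1 / p)) * rearrangement f n \<le> ennreal M"
    by (simp add: w_def)
qed

lemma d_inf_normD:
  assumes "f \<in> d_inf \<Omega> p" "finite A" "A \<noteq> {}" "\<And>k. k \<in> A \<Longrightarrow> c \<le> cmod (f k)"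
  shows "w (card A - 1) * c \<le> enn2real (d_inf_norm \<Omega> p f)"
proof -
  have "d_inf_norm \<Omega> p f = ennreal (enn2real (d_inf_norm \<Omega> p f))"
    using assms(1) by (simp add: d_inf_def)
  then have "ennreal (w (card A - 1) * c) \<le> ennreal (enn2real (d_inf_norm \<Omega> p f))"
    using d_inf_norm_ge[OF assms(2-4)] by simp
  then show ?thesis by (simp add: ennreal_le_iff)
qed

lemma d_inf_normI:
  assumes "M \<ge> 0"
    and "\<And>A c. finite A \<Longrightarrow> A \<noteq> {} \<Longrightarrow> c > 0 \<Longrightarrow> (\<And>k. k \<in> A \<Longrightarrow> c \<le> cmod (f k)) \<Longrightarrow> w (card A - 1) * c \<le> M"
  shows "f \<in> d_inf \<Omega> p" "enn2real (d_inf_norm \<Omega> p f) \<le> M"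
proof -
  have le: "d_inf_norm \<Omega> p f \<le> ennreal M" using assms by (rule d_inf_norm_le)
  then show "f \<in> d_inf \<Omega> p"
    by (simp add: d_inf_def order_le_less_trans[OF le])
  show "enn2real (d_inf_norm \<Omega> p f) \<le> M"
    using enn2real_mono[OF le] assms(1) by simp
qed

section \<open>Cyclic shifts and the necessity of the condition\<close>

definition shifted_inverse :: "nat \<Rightarrow> nat \<Rightarrow> nat \<Rightarrow> complex" where
  "shifted_inverse n j k = (if k \<le> n then of_real (1 / w ((j + k) mod Suc n)) else 0)"

lemma inj_on_add_mod: "inj_on (\<lambda>k. (j + k) mod Suc n) {..n}"
proof (rule inj_onI)
  fix x y assume "x \<in> {..n}" "y \<in> {..n}" and eq: "(j + x) mod Suc n = (j + y) mod Suc n"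
  \<comment> \<open>Over the integers, equal residues mean that the modulus divides the difference,
    from which \<open>j\<close> cancels.\<close>
  then have "int (j + x) mod int (Suc n) = int (j + y) mod int (Suc n)"
    by (metis zmod_int)
  then have "int x mod int (Suc n) = int y mod int (Suc n)"
    by (simp add: mod_eq_dvd_iff)
  then have "x mod Suc n = y mod Suc n"
    by (metis of_nat_eq_iff zmod_int)
  with \<open>x \<in> {..n}\<close> \<open>y \<in> {..n}\<close> show "x = y" by simp
qed

lemma shifted_inverse_norm:
  shows "shifted_inverse n j \<in> d_inf \<Omega> p"
    and "enn2real (d_inf_norm \<Omega> p (shifted_inverse n j)) \<le> 1"
proof -
  have *: "w (card A - 1) * c \<le> 1"
    if A: "finite A" "A \<noteq> {}" "c > 0" and c: "\<And>k. k \<in> A \<Longrightarrow> c \<le> cmod (shifted_inverse n j k)" for A c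
  proof -
    let ?h = "\<lambda>k. (j + k) mod Suc n"
    \<comment> \<open>Beyond \<open>n\<close> the sequence vanishes, which \<open>c > 0\<close>
      rules out on \<open>A\<close>.\<close>
    have sub: "A \<subseteq> {..n}"
    proof
      fix k assume "k \<in> A"
      with c[OF this] \<open>c > 0\<close> show "k \<in> {..n}" by (auto simp: shifted_inverse_def split: if_splits)
    qed
    have card: "card (?h ` A) = card A"
      by (rule card_image, rule inj_on_subset[OF inj_on_add_mod sub])
    \<comment> \<open>Pigeonhole: \<open>card A\<close> distinct values of \<open>?h\<close> do not
      fit below \<open>card A - 1\<close>. At an index \<open>k\<close> with a large value,
      monotonicity of \<open>w\<close> gives the bound 1.\<close>
    have "\<exists>k\<in>A. card A - 1 \<le> ?h k"
    proof (rule ccontr)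
      assume "\<not> ?thesis"
      then have "?h ` A \<subseteq> {..<card A - 1}" by auto
      then have "card (?h ` A) \<le> card A - 1"
        using card_mono[of "{..<card A - 1}" "?h ` A"] by simp
      then show False using card A by (metis card_gt_0_iff diff_less leD zero_less_one)
    qed
    then obtain k where k: "k \<in> A" "card A - 1 \<le> ?h k" by blast
    have "c \<le> 1 / w (?h k)"
      using c[OF k(1)] sub k(1) by (auto simp: shifted_inverse_def norm_divide)
    then have "w (?h k) * c \<le> 1" by (simp add: field_simps)
    moreover have "w (card A - 1) * c \<le> w (?h k) * c"
      using k(2) \<open>c > 0\<close> by (intro mult_right_mono w_mono) auto
    ultimately show ?thesis by linarith
  qed
  show "shifted_inverse n j \<in> d_inf \<Omega> p"
    and "enn2real (d_inf_norm \<Omega> p (shifted_inverse n j)) \<le> 1"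
    using d_inf_normI[of 1 "shifted_inverse n j"] * by auto
qed

text \<open>For fixed \<open>k\<close> the roles of \<open>j\<close> and \<open>k\<close> are
  symmetric, so \<open>j\<close> runs through every residue exactly once: an injective map of
  \<open>{..n}\<close> into itself is onto. Hence the value does not depend on
  \<open>k\<close>.\<close>

lemma sum_shifted_inverse:
  assumes "k \<le> n"
  shows "(\<Sum>j\<le>n. shifted_inverse n j) k = of_real (\<Sum>i\<le>n. 1 / w i)"
proof -
  have inj: "inj_on (\<lambda>j. (j + k) mod Suc n) {..n}"
    using inj_on_add_mod[of k n] by (simp add: add.commute)
  then have img: "(\<lambda>j. (j + k) mod Suc n) ` {..n} = {..n}"
    by (intro endo_inj_surj) (auto simp: less_Suc_eq_le[symmetric])
  have "(\<Sum>j\<in>J. shifted_inverse n j) k = (\<Sum>j\<in>J. shifted_inverse n j k)" if "finite J" for J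
    using that by (induction J rule: finite_induct) simp_all
  then have "(\<Sum>j\<le>n. shifted_inverse n j) k = (\<Sum>j\<le>n. shifted_inverse n j k)" by simp
  also have "\<dots> = of_real (\<Sum>j\<le>n. 1 / w ((j + k) mod Suc n))"
    using assms by (simp add: shifted_inverse_def)
  also have "(\<Sum>j\<le>n. 1 / w ((j + k) mod Suc n)) = (\<Sum>i\<le>n. 1 / w i)"
    using sum.reindex[OF inj, of "\<lambda>i. 1 / w i"] img by simp
  finally show ?thesis .
qed

text \<open>For the sum \<open>g\<close> of the shifts,
  \<open>a * w n * S \<le> N g \<le> (n + 1) * b\<close>: the left bound tests \<open>g\<close> on
  \<open>{..n}\<close>, where it equals \<open>S\<close>, and the right one is the triangle
  inequality. Keeping \<open>a\<close> and \<open>b\<close> explicit covers both parts of the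
  theorem.\<close>

lemma sum_inverse_le_of_norm:
  assumes N: "is_norm_on (d_inf \<Omega> p) N" and "a > 0" "b \<ge> 0"
    and lower: "\<And>f. f \<in> d_inf \<Omega> p \<Longrightarrow> a * enn2real (d_inf_norm \<Omega> p f) \<le> N f"
    and upper: "\<And>f. f \<in> d_inf \<Omega> p \<Longrightarrow> N f \<le> b * enn2real (d_inf_norm \<Omega> p f)"
  shows "(\<Sum>k\<le>n. 1 / w k) \<le> b / a * (real (n + 1) / w n)"
proof -
  define g where "g = (\<Sum>j\<le>n. shifted_inverse n j)"
  define S where "S = (\<Sum>k\<le>n. 1 / w k)"
  have "S \<ge> 0" unfolding S_def by (intro sum_nonneg) simp
  have g: "g \<in> d_inf \<Omega> p"
    unfolding g_def using N shifted_inverse_norm(1)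
    by (intro cseq.subspace_sum) (auto simp: is_norm_on_def)
  have "w (card {..n} - 1) * S \<le> enn2real (d_inf_norm \<Omega> p g)"
    using g \<open>S \<ge> 0\<close> by (intro d_inf_normD) (auto simp: g_def sum_shifted_inverse S_def simp del: of_real_sum)
  then have "a * (w n * S) \<le> N g"
    using lower[OF g] \<open>a > 0\<close> by (simp add: order_trans[OF mult_left_mono])
  also have "N g \<le> (\<Sum>j\<le>n. N (shifted_inverse n j))"
    unfolding g_def using N shifted_inverse_norm(1) by (intro is_norm_on_sum_le) auto
  also have "\<dots> \<le> (\<Sum>j\<le>n. b)"
  proof (rule sum_mono)
    fix j
    show "N (shifted_inverse n j) \<le> b"
      using upper[OF shifted_inverse_norm(1)[of n j]]
        mult_left_mono[OF shifted_inverse_norm(2)[of n j] \<open>b \<ge> 0\<close>] by simp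
  qed
  finally show ?thesis
    using \<open>a > 0\<close> by (simp add: S_def field_simps)
qed

section \<open>Weighted means over finite sets\<close>

definition weighted_mean :: "(nat \<Rightarrow> complex) \<Rightarrow> nat set \<Rightarrow> real" where
  "weighted_mean f A = w (card A - 1) / card A * (\<Sum>k\<in>A. cmod (f k))"

text \<open>When finite, this is the supremum of \<open>w n\<close> times the average of the first
  \<open>n + 1\<close> values of the rearrangement. Averaging over arbitrary finite sets makes
  subadditivity immediate. As the supremum is real, its upper bound property requires bounded
  means.\<close>

definition sup_mean :: "(nat \<Rightarrow> complex) \<Rightarrow> real" where
  "sup_mean f = (SUP A\<in>{A. finite A \<and> A \<noteq> {}}. weighted_mean f A)"

lemma weighted_mean_add: "weighted_mean (f + g) A \<le> weighted_mean f A + weighted_mean g A"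
proof -
  have "(\<Sum>k\<in>A. cmod ((f + g) k)) \<le> (\<Sum>k\<in>A. cmod (f k)) + (\<Sum>k\<in>A. cmod (g k))"
    unfolding sum.distrib[symmetric] by (intro sum_mono) (simp add: norm_triangle_ineq)
  then show ?thesis
    unfolding weighted_mean_def distrib_left[symmetric] by (intro mult_left_mono) auto
qed

lemma weighted_mean_scale: "weighted_mean (seq_scale c f) A = cmod c * weighted_mean f A"
  by (simp add: weighted_mean_def seq_scale_def norm_mult sum_distrib_left[symmetric])

lemma le_weighted_mean:
  assumes "finite A" "A \<noteq> {}" "\<And>k. k \<in> A \<Longrightarrow> c \<le> cmod (f k)"
  shows "w (card A - 1) * c \<le> weighted_mean f A"
proof -
  have card: "card A > 0" using assms by (simp add: card_gt_0_iff)
  have "card A * c \<le> (\<Sum>k\<in>A. cmod (f k))"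
    using assms(3) by (rule sum_bounded_below)
  then have "w (card A - 1) / card A * (card A * c) \<le> weighted_mean f A"
    unfolding weighted_mean_def by (intro mult_left_mono) auto
  with card show ?thesis by simp
qed

text \<open>The smallest value of \<open>|f|\<close> on \<open>A\<close> is at most \<open>\<parallel>f\<parallel> / w\<^bsub>|A|-1\<^esub>\<close>; remove it and induct.\<close>

lemma sum_le_norm:
  assumes "f \<in> d_inf \<Omega> p" "finite A"
  shows "(\<Sum>k\<in>A. cmod (f k)) \<le> enn2real (d_inf_norm \<Omega> p f) * (\<Sum>k<card A. 1 / w k)"
  using assms(2)
proof (induction "card A" arbitrary: A)
  case 0
  then show ?case by simp
next
  case (Suc m)
  then have "A \<noteq> {}" by auto
  then obtain x where x: "x \<in> A" "\<And>k. k \<in> A \<Longrightarrow> cmod (f x) \<le> cmod (f k)"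
    using ex_is_arg_min_if_finite[OF Suc.prems, of "\<lambda>k. cmod (f k)"]
    by (auto simp: is_arg_min_linorder)
  have card: "card (A - {x}) = m" using Suc x by simp
  have "w (card A - 1) * cmod (f x) \<le> enn2real (d_inf_norm \<Omega> p f)"
    using assms(1) Suc.prems \<open>A \<noteq> {}\<close> x(2) by (rule d_inf_normD)
  then have "cmod (f x) \<le> enn2real (d_inf_norm \<Omega> p f) * (1 / w m)"
    using Suc.hyps(2)[symmetric] by (simp add: field_simps)
  moreover have "(\<Sum>k\<in>A - {x}. cmod (f k)) \<le> enn2real (d_inf_norm \<Omega> p f) * (\<Sum>k<m. 1 / w k)"
    using Suc.hyps(1)[of "A - {x}"] Suc.prems card by simp
  moreover have "(\<Sum>k\<in>A. cmod (f k)) = cmod (f x) + (\<Sum>k\<in>A - {x}. cmod (f k))"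
    using Suc.prems x(1) by (rule sum.remove)
  ultimately show ?case
    unfolding Suc.hyps(2)[symmetric] by (simp add: distrib_left)
qed

section \<open>The supremum of the means as an equivalent norm\<close>

context
  fixes C :: real
  assumes sum_inverse_le: "\<And>n. (\<Sum>k\<le>n. 1 / w k) \<le> C * (real (n + 1) / w n)"
begin

lemma weighted_mean_le:
  assumes "f \<in> d_inf \<Omega> p" "finite A" "A \<noteq> {}"
  shows "weighted_mean f A \<le> C * enn2real (d_inf_norm \<Omega> p f)"
proof -
  obtain m where m: "card A = Suc m"
    using assms by (metis card_gt_0_iff gr0_implies_Suc)
  have "weighted_mean f A \<le> w m / Suc m * (enn2real (d_inf_norm \<Omega> p f) * (\<Sum>k\<le>m. 1 / w k))"
    unfolding weighted_mean_def using sum_le_norm[OF assms(1,2)] m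
    by (intro mult_mono) (auto simp: lessThan_Suc_atMost intro: sum_nonneg)
  \<comment> \<open>The condition at \<open>m = card A - 1\<close> cancels the factor
    \<open>w m / Suc m\<close> exactly.\<close>
  also have "\<dots> \<le> w m / Suc m * (enn2real (d_inf_norm \<Omega> p f) * (C * (real (m + 1) / w m)))"
    using sum_inverse_le by (intro mult_left_mono) auto
  also have "\<dots> = C * enn2real (d_inf_norm \<Omega> p f)"
    by simp
  finally show ?thesis .
qed

lemma weighted_mean_le_sup_mean:
  assumes "f \<in> d_inf \<Omega> p" "finite A" "A \<noteq> {}"
  shows "weighted_mean f A \<le> sup_mean f"
  unfolding sup_mean_def
  using assms weighted_mean_le by (intro cSUP_upper bdd_aboveI2) auto

lemma sup_mean_least:
  assumes "\<And>A. finite A \<Longrightarrow> A \<noteq> {} \<Longrightarrow> weighted_mean f A \<le> M"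
  shows "sup_mean f \<le> M"
  unfolding sup_mean_def using assms by (intro cSUP_least) auto

lemma sup_mean_le:
  assumes "f \<in> d_inf \<Omega> p"
  shows "sup_mean f \<le> C * enn2real (d_inf_norm \<Omega> p f)"
  using assms by (intro sup_mean_least weighted_mean_le)

lemma cmod_le_sup_mean:
  assumes "f \<in> d_inf \<Omega> p"
  shows "w 0 * cmod (f k) \<le> sup_mean f"
  using weighted_mean_le_sup_mean[OF assms, of "{k}"] by (simp add: weighted_mean_def)

lemma sup_mean_nonneg:
  assumes "f \<in> d_inf \<Omega> p"
  shows "sup_mean f \<ge> 0"
  by (rule order_trans[OF _ cmod_le_sup_mean[OF assms, of 0]]) simp

text \<open>A lower bound of \<open>cmod (f k)\<close> on \<open>A\<close> is at most the mean.
  Membership is a conclusion here, so one bound on the means yields both closure of the space and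
  the norm inequality for sums and multiples.\<close>

lemma norm_le_of_mean_le:
  assumes "\<And>A. finite A \<Longrightarrow> A \<noteq> {} \<Longrightarrow> weighted_mean f A \<le> M" "M \<ge> 0"
  shows "f \<in> d_inf \<Omega> p" "enn2real (d_inf_norm \<Omega> p f) \<le> M"
proof -
  have "w (card A - 1) * c \<le> M"
    if A: "finite A" "A \<noteq> {}" and c: "\<And>k. k \<in> A \<Longrightarrow> c \<le> cmod (f k)" for A c
    using le_weighted_mean[where f = f, OF A c] assms(1)[OF A] by linarith
  then show "f \<in> d_inf \<Omega> p" "enn2real (d_inf_norm \<Omega> p f) \<le> M"
    using d_inf_normI[of M f] \<open>M \<ge> 0\<close> by auto
qed

lemma norm_le_sup_mean:
  assumes "f \<in> d_inf \<Omega> p"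
  shows "enn2real (d_inf_norm \<Omega> p f) \<le> sup_mean f"
  using assms weighted_mean_le_sup_mean sup_mean_nonneg by (intro norm_le_of_mean_le(2)) auto

lemma sup_mean_scale_le:
  assumes "f \<in> d_inf \<Omega> p"
  shows "seq_scale c f \<in> d_inf \<Omega> p" "sup_mean (seq_scale c f) \<le> cmod c * sup_mean f"
proof -
  have "weighted_mean (seq_scale c f) A \<le> cmod c * sup_mean f" if "finite A" "A \<noteq> {}" for A
    unfolding weighted_mean_scale
    using weighted_mean_le_sup_mean[OF assms that] by (intro mult_left_mono) auto
  then show "seq_scale c f \<in> d_inf \<Omega> p" "sup_mean (seq_scale c f) \<le> cmod c * sup_mean f"
    using norm_le_of_mean_le(1)[of "seq_scale c f" "cmod c * sup_mean f"] sup_mean_nonneg[OF assms]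
    by (auto intro: sup_mean_least)
qed

text \<open>For nonzero \<open>c\<close> the missing inequality is \<open>sup_mean_scale_le\<close>
  applied to \<open>inverse c\<close> and \<open>seq_scale c f\<close>.\<close>

lemma sup_mean_scale:
  assumes "f \<in> d_inf \<Omega> p"
  shows "sup_mean (seq_scale c f) = cmod c * sup_mean f"
proof (cases "c = 0")
  case True
  then show ?thesis
    using sup_mean_scale_le[OF assms, of c] sup_mean_nonneg[of "seq_scale c f"] by simp
next
  case False
  then have "seq_scale (inverse c) (seq_scale c f) = f" by simp
  then have "sup_mean f \<le> cmod (inverse c) * sup_mean (seq_scale c f)"
    using sup_mean_scale_le(2)[OF sup_mean_scale_le(1)[OF assms], of "inverse c" c] by simp
  then have "cmod c * sup_mean f \<le> sup_mean (seq_scale c f)"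
    using False by (simp add: norm_divide field_simps)
  then show ?thesis using sup_mean_scale_le(2)[OF assms, of c] by simp
qed

lemma sup_mean_add:
  assumes "f \<in> d_inf \<Omega> p" "g \<in> d_inf \<Omega> p"
  shows "f + g \<in> d_inf \<Omega> p" "sup_mean (f + g) \<le> sup_mean f + sup_mean g"
proof -
  have "weighted_mean (f + g) A \<le> sup_mean f + sup_mean g" if "finite A" "A \<noteq> {}" for A
    using weighted_mean_add[of f g A] weighted_mean_le_sup_mean[OF _ that] assms
    by (meson add_mono order_trans)
  then show "f + g \<in> d_inf \<Omega> p" "sup_mean (f + g) \<le> sup_mean f + sup_mean g"
    using norm_le_of_mean_le(1)[of "f + g" "sup_mean f + sup_mean g"] sup_mean_nonneg assms
    by (auto intro: sup_mean_least)
qed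

lemma is_norm_on_sup_mean: "is_norm_on (d_inf \<Omega> p) sup_mean"
proof -
  have zero: "0 \<in> d_inf \<Omega> p" "sup_mean 0 \<le> 0"
  proof -
    show "0 \<in> d_inf \<Omega> p"
      by (rule norm_le_of_mean_le(1)[of _ 0]) (simp_all add: weighted_mean_def)
    show "sup_mean 0 \<le> 0"
      by (rule sup_mean_least) (simp add: weighted_mean_def)
  qed
  have "f = 0" if "f \<in> d_inf \<Omega> p" "sup_mean f = 0" for f
  proof
    fix k
    \<comment> \<open>Definiteness comes from singletons, whose weight is
      \<open>w 0 > 0\<close>.\<close>
    have "w 0 * cmod (f k) \<le> 0" using cmod_le_sup_mean[OF that(1), of k] that(2) by simp
    then show "f k = 0 k" using w_pos[of 0] by (simp add: mult_le_0_iff)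
  qed
  moreover have "cseq.subspace (d_inf \<Omega> p)"
    using zero sup_mean_add(1) sup_mean_scale_le(1) by (simp add: cseq.subspace_def)
  ultimately show ?thesis
    using zero sup_mean_nonneg sup_mean_scale sup_mean_add(2)
    unfolding is_norm_on_def by (auto intro: antisym)
qed

end

section \<open>The two equivalences\<close>

lemma is_norm_on_d_inf_norm_iff:
  "is_norm_on (d_inf \<Omega> p) (\<lambda>f. enn2real (d_inf_norm \<Omega> p f)) \<longleftrightarrow>
     \<Omega> = (\<lambda>n. if n = 0 then \<Omega> 0 else 0)"
proof
  assume N: "is_norm_on (d_inf \<Omega> p) (\<lambda>f. enn2real (d_inf_norm \<Omega> p f))"
  have "w n = w 0" for n
  proof -
    have "(\<Sum>k\<le>n. 1 / w k) \<le> real (n + 1) / w n"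
      using sum_inverse_le_of_norm[OF N, of 1 1 n] by simp
    \<comment> \<open>As \<open>w\<close> is nondecreasing, the differences
      \<open>1 / w k - 1 / w n\<close> are nonnegative; a sum at most 0 makes each vanish, in
      particular the one at 0.\<close>
    also have "\<dots> = (\<Sum>k\<le>n. 1 / w n)" by simp
    finally have "(\<Sum>k\<le>n. 1 / w k - 1 / w n) \<le> 0" by (simp add: sum_subtractf)
    moreover have nonneg: "1 / w k - 1 / w n \<ge> 0" if "k \<le> n" for k
      using w_mono[OF that] by (simp add: frac_le)
    ultimately have "1 / w 0 - 1 / w n \<le> 0"
      using member_le_sum[of 0 "{..n}" "\<lambda>k. 1 / w k - 1 / w n"] by fastforce
    with nonneg[of 0] have "1 / w 0 = 1 / w n" by simp
    then show ?thesis by simp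
  qed
  then have const: "weight_sum \<Omega> n = weight_sum \<Omega> 0" for n
    by (simp add: w_eq_iff)
  have "\<Omega> (Suc n) = 0" for n
    using const[of "Suc n"] const[of n] by (simp add: weight_sum_def)
  then show "\<Omega> = (\<lambda>n. if n = 0 then \<Omega> 0 else 0)"
    by (metis not0_implies_Suc)
next
  assume \<Omega>: "\<Omega> = (\<lambda>n. if n = 0 then \<Omega> 0 else 0)"
  have "weight_sum \<Omega> n = weight_sum \<Omega> 0" for n
    unfolding weight_sum_def by (subst (1 2) \<Omega>) (simp add: sum.delta)
  then have const: "w n = w 0" for n by (simp add: w_eq_iff)
  have C: "(\<Sum>k\<le>n. 1 / w k) \<le> 1 * (real (n + 1) / w n)" for n
    unfolding const[of n] by (subst const) simp
  \<comment> \<open>With \<open>C = 1\<close> the lower and upper comparisons of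
    \<open>sup_mean\<close> with the functional coincide.\<close>
  have "sup_mean f = enn2real (d_inf_norm \<Omega> p f)" if "f \<in> d_inf \<Omega> p" for f
    using norm_le_sup_mean[OF C that] sup_mean_le[OF C that] by simp
  then show "is_norm_on (d_inf \<Omega> p) (\<lambda>f. enn2real (d_inf_norm \<Omega> p f))"
    by (rule is_norm_on_cong[OF is_norm_on_sup_mean[OF C]])
qed

lemma d_inf_normable_iff:
  "d_inf_normable \<Omega> p \<longleftrightarrow> (\<exists>C. \<forall>n. (\<Sum>k\<le>n. 1 / w k) \<le> C * (real (n + 1) / w n))"
proof
  assume "d_inf_normable \<Omega> p"
  then obtain N a b where "is_norm_on (d_inf \<Omega> p) N" "0 < a" "0 < b"
    "\<And>f. f \<in> d_inf \<Omega> p \<Longrightarrow> a * enn2real (d_inf_norm \<Omega> p f) \<le> N f"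
    "\<And>f. f \<in> d_inf \<Omega> p \<Longrightarrow> N f \<le> b * enn2real (d_inf_norm \<Omega> p f)"
    unfolding d_inf_normable_def by blast
  then have "(\<Sum>k\<le>n. 1 / w k) \<le> b / a * (real (n + 1) / w n)" for n
    by (intro sum_inverse_le_of_norm) auto
  then show "\<exists>C. \<forall>n. (\<Sum>k\<le>n. 1 / w k) \<le> C * (real (n + 1) / w n)" by blast
next
  assume "\<exists>C. \<forall>n. (\<Sum>k\<le>n. 1 / w k) \<le> C * (real (n + 1) / w n)"
  then obtain C where C: "\<And>n. (\<Sum>k\<le>n. 1 / w k) \<le> C * (real (n + 1) / w n)" by blast
  \<comment> \<open>Normability asks for a positive upper constant; the condition at
    \<open>n = 0\<close> shows that \<open>C\<close> is one.\<close>
  have "0 < 1 / w 0" by simp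
  also have "\<dots> \<le> C / w 0" using C[of 0] by simp
  finally have "C > 0" using w_pos[of 0] by (simp add: zero_less_divide_iff)
  moreover have "1 * enn2real (d_inf_norm \<Omega> p f) \<le> sup_mean f \<and> sup_mean f \<le> C * enn2real (d_inf_norm \<Omega> p f)"
    if "f \<in> d_inf \<Omega> p" for f
    using norm_le_sup_mean[OF C that] sup_mean_le[OF C that] by simp
  ultimately show "d_inf_normable \<Omega> p"
    unfolding d_inf_normable_def using is_norm_on_sup_mean[OF C] zero_less_one by blast
qed

end

theorem theorem2p5p11:
  fixes p :: real and \<Omega> :: "nat \<Rightarrow> real"
  assumes "0 < p"
    and "\<And>n. \<Omega> n \<ge> 0"
    and "\<Omega> 0 \<noteq> 0"
  shows "(is_norm_on (d_inf \<Omega> p) (\<lambda>f. enn2real (d_inf_norm \<Omega> p f)) \<longleftrightarrow>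
            \<Omega> = (\<lambda>n. if n = 0 then \<Omega> 0 else 0)) \<and>
         (d_inf_normable \<Omega> p \<longleftrightarrow>
            (\<exists>C::real. \<forall>n. (\<Sum>k\<le>n. 1 / weight_sum \<Omega> k powr (1 / p))
                            \<le> C * (real (n + 1) / weight_sum \<Omega> n powr (1 / p))))"
proof -
  interpret lorentz_weight \<Omega> p
    using assms by unfold_locales
  show ?thesis
    using is_norm_on_d_inf_norm_iff d_inf_normable_iff unfolding w_def by blast
qed

end
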